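(* Let $n\ge 1$ and $s\ge 2$ be integers, let $Z=\{z_1,\dots,z_s\}\subset B_2^n\subset\mathbb{R}^n$ be a set of $s$ distinct points, and let $N\ge s-1$ be an integer. Then for every $j\in\{1,\dots,s\}$, the Euclidean distance between the row $V_N(z_j)$ and the subspace $W_j=\mathrm{span}\{V_N(z_i): i\ne j\}\subset\mathbb{R}^\nu$ satisfies $$\operatorname{dist}(V_N(z_j),W_j)\ge\frac{\rho(Z,j)^{s-1}}{(4n)^{s-1}\,s\,\sqrt{\nu}}.$$
   Context: $B_2^n=\{x\in\mathbb{R}^n:\|x\|_2\le 1\}$. $\nu=\nu(n,N)=\binom{N+n}{N}$ is the number of monomials $z^\alpha=\prod_\ell z_\ell^{\alpha_\ell}$ in $n$ variables with $\alpha\in\mathbb{Z}_{\ge0}^n$, $|\alpha|=\sum_\ell\alpha_\ell\le N$. For $z\in\mathbb{R}^n$, $V_N(z)=(z^\alpha)_{|\alpha|\le N}\in\mathbb{R}^\nu$ (in a fixed ordering of the multi-indices, with $0^0=1$). The max–min projection separation is $\rho(Z,j)=\max_{\|v\|_2=1}\min_{i\ne j}|\langle v,z_j-z_i\rangle|$, the maximum being over $v\in\mathbb{R}^n$; it is positive since the points are distinct. *)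

theory Defs
  imports "HOL-Analysis.Analysis" "HOL-Library.Multiset"
begin

definition multi_indices :: "nat \<Rightarrow> ('n::finite \<Rightarrow> nat) set" where
  "multi_indices N = {\<alpha>. (\<Sum>l\<in>UNIV. \<alpha> l) \<le> N}"

lemma card_multi_indices:
  "card (multi_indices N :: ('n::finite \<Rightarrow> nat) set) = (N + CARD('n)) choose N"
proof -
  let ?h = "\<lambda>(X :: 'n option multiset) l. count X (Some l)"
  have size: "size X = count X None + (\<Sum>l\<in>UNIV. count X (Some l))" for X :: "'n option multiset"
  proof -
    have "size X = (\<Sum>x\<in>UNIV. count X x)"
      unfolding size_multiset_overloaded_eq
      by (rule sum.mono_neutral_left) (auto simp: not_in_iff)
    then show ?thesis by (simp add: UNIV_option_conv sum.reindex)
  qed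
  have "bij_betw ?h (multisets_of_size UNIV N) (multi_indices N)"
    unfolding bij_betw_def
  proof
    show "inj_on ?h (multisets_of_size UNIV N)"
    proof (rule inj_onI)
      fix X Y assume *: "X \<in> multisets_of_size UNIV N" "Y \<in> multisets_of_size UNIV N" "?h X = ?h Y"
      have some: "count X (Some l) = count Y (Some l)" for l using fun_cong[OF *(3)] .
      have "count X None = count Y None"
        using * size[of X] size[of Y] some by (simp add: multisets_of_size_def)
      then show "X = Y" using some by (metis multiset_eqI not_None_eq)
    qed
    show "?h ` multisets_of_size UNIV N = multi_indices N"
    proof (intro equalityI subsetI)
      fix \<alpha> assume "\<alpha> \<in> ?h ` multisets_of_size UNIV N"
      then show "\<alpha> \<in> multi_indices N" by (auto simp: multisets_of_size_def multi_indices_def size)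
    next
      fix \<alpha> :: "'n \<Rightarrow> nat" assume \<alpha>: "\<alpha> \<in> multi_indices N"
      define X where "X = Abs_multiset (case_option (N - sum \<alpha> UNIV) \<alpha>)"
      have X: "count X = case_option (N - sum \<alpha> UNIV) \<alpha>"
        unfolding X_def by (rule count_Abs_multiset) (rule finite_subset[OF subset_UNIV], simp)
      then have "?h X = \<alpha>" "X \<in> multisets_of_size UNIV N"
        using \<alpha> by (auto simp: multisets_of_size_def multi_indices_def size)
      then show "\<alpha> \<in> ?h ` multisets_of_size UNIV N" by blast
    qed
  qed
  from bij_betw_same_card[OF this] show ?thesis
    by (simp add: card_multisets_of_size add.commute)
qed

text \<open>
  The ambient space of the rows is \<open>real ^ 'v\<close>, where an ordering of the multi-indices is a bijection
  \<open>e\<close> from the coordinate type \<open>'v\<close> onto \<open>multi_indices N\<close>, so \<open>CARD('v)\<close>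
  equals \<open>(N + n) choose N\<close>.
\<close>

definition vandermonde_row :: "('v::finite \<Rightarrow> 'n::finite \<Rightarrow> nat) \<Rightarrow> real ^ 'n \<Rightarrow> real ^ 'v" where
  "vandermonde_row e z = (\<chi> k. \<Prod>l\<in>UNIV. (z $ l) ^ e k l)"

text \<open>
  The supremum over the unit sphere is a maximum for finite \<open>I\<close> with \<open>I - {j} \<noteq> {}\<close>, see
  \<open>proj_sep_attained\<close> below.
\<close>

definition proj_sep :: "'i set \<Rightarrow> ('i \<Rightarrow> real ^ 'n) \<Rightarrow> 'i \<Rightarrow> real" where
  "proj_sep I z j = (SUP v\<in>sphere 0 1. MIN i\<in>I - {j}. \<bar>v \<bullet> (z j - z i)\<bar>)"

lemma continuous_on_Min_finite:
  fixes f :: "'i \<Rightarrow> 'a::topological_space \<Rightarrow> real"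
  assumes "finite I" "I \<noteq> {}" "\<And>i. i \<in> I \<Longrightarrow> continuous_on S (f i)"
  shows "continuous_on S (\<lambda>x. MIN i\<in>I. f i x)"
  using assms
proof (induction I rule: finite_ne_induct)
  case (insert i F)
  then show ?case by (auto intro!: continuous_intros)
qed simp

lemma proj_sep_attained:
  fixes z :: "'i \<Rightarrow> real ^ 'n"
  assumes "finite I" "I - {j} \<noteq> {}"
  shows "\<exists>v\<in>sphere 0 1. proj_sep I z j = (MIN i\<in>I - {j}. \<bar>v \<bullet> (z j - z i)\<bar>) \<and>
           (\<forall>u\<in>sphere 0 1. (MIN i\<in>I - {j}. \<bar>u \<bullet> (z j - z i)\<bar>) \<le> proj_sep I z j)"
proof -
  let ?g = "\<lambda>v. MIN i\<in>I - {j}. \<bar>v \<bullet> (z j - z i)\<bar>"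
  have "continuous_on (sphere 0 1) ?g"
    using assms by (intro continuous_on_Min_finite) (auto intro!: continuous_intros)
  moreover have "sphere (0 :: real ^ 'n) 1 \<noteq> {}" by simp
  ultimately obtain v where v: "v \<in> sphere 0 1" "\<And>u. u \<in> sphere 0 1 \<Longrightarrow> ?g u \<le> ?g v"
    using continuous_attains_sup[OF compact_sphere, of "0 :: real ^ 'n" 1 ?g] by blast
  then have "proj_sep I z j = ?g v"
    unfolding proj_sep_def by (intro cSup_eq_maximum) auto
  with v show ?thesis by auto
qed

end

theory Submission
  imports Defs
begin

text \<open>
  Let \<open>v\<close> be a unit vector attaining \<open>proj_sep\<close>. The polynomial \<open>p x = (\<Prod>i\<noteq>j. v \<bullet> x - v \<bullet> z i)\<close> has degree
  \<open>s - 1 \<le> N\<close>, so \<open>p x = c \<bullet> vandermonde_row e x\<close> for its coefficient vector \<open>c\<close>. This \<open>c\<close> is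
  orthogonal to all rows except the \<open>j\<close>-th, hence the distance is at least \<open>\<bar>p (z j)\<bar> / norm c\<close>.
  Here \<open>\<bar>p (z j)\<bar>\<close> is at least the \<open>(s - 1)\<close>-st power of the separation, and expanding the product
  bounds the \<open>l\<^sup>1\<close>-norm of \<open>c\<close>, hence also \<open>norm c\<close>, by \<open>(n + 1)\<close> to the power \<open>s - 1\<close>.
\<close>

text \<open>The closed subspace \<open>span S\<close> contains a nearest point \<open>x\<close> to
  \<open>y\<close>. As \<open>c\<close> is orthogonal to \<open>x\<close>, replacing
  \<open>y\<close> by \<open>y - x\<close> leaves the inner product unchanged, and Cauchy-Schwarz
  applies.\<close>

lemma abs_inner_le_norm_times_infdist_span:
  fixes c y :: "'a::euclidean_space"
  assumes "\<And>x. x \<in> S \<Longrightarrow> c \<bullet> x = 0"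
  shows "\<bar>c \<bullet> y\<bar> \<le> norm c * infdist y (span S)"
proof -
  have "closed (span S)" "span S \<noteq> {}"
    using span_zero[of S] by auto
  then obtain x where x: "x \<in> span S" "infdist y (span S) = dist y x"
    by (rule infdist_attains_inf)
  have "orthogonal c x"
    using assms by (intro orthogonal_to_span[OF x(1)]) (auto simp: orthogonal_def)
  then have "c \<bullet> y = c \<bullet> (y - x)"
    by (simp add: inner_diff_right orthogonal_def)
  then show ?thesis
    using Cauchy_Schwarz_ineq2[of c "y - x"] x(2) by (simp add: dist_norm)
qed

text \<open>Multiplying out, each choice \<open>f\<close> of one term per factor yields one
  monomial, with exponent \<open>\<alpha> f\<close>. The triangle inequality over all choices gives
  the norm bound, since the sum of absolute values factors again.\<close>

lemma prod_affine_eq_inner_vandermonde_row: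
  fixes e :: "'v::finite \<Rightarrow> 'n::finite \<Rightarrow> nat" and w :: "'i \<Rightarrow> real ^ 'n" and b :: "'i \<Rightarrow> real"
  assumes e: "multi_indices N \<subseteq> range e" and J: "finite J" "card J \<le> N"
  obtains c where "\<And>x. c \<bullet> vandermonde_row e x = (\<Prod>i\<in>J. w i \<bullet> x - b i)"
    and "norm c \<le> (\<Prod>i\<in>J. (\<Sum>l\<in>UNIV. \<bar>w i $ l\<bar>) + \<bar>b i\<bar>)"
proof -
  \<comment> \<open>The index \<open>None\<close> stands for the constant term of an affine form.\<close>
  define W where "W i = case_option (- b i) (\<lambda>l. w i $ l)" for i
  define F where "F = J \<rightarrow>\<^sub>E (UNIV :: 'n option set)"
  define \<alpha> where "\<alpha> f l = card {i \<in> J. f i = Some l}" for f :: "'i \<Rightarrow> 'n option" and l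
  \<comment> \<open>Choices with the same exponent add up in the same coordinate.\<close>
  define c :: "real ^ 'v" where "c = (\<Sum>f\<in>F. (\<Prod>i\<in>J. W i (f i)) *\<^sub>R axis (inv e (\<alpha> f)) 1)"
  have e_inv: "e (inv e (\<alpha> f)) = \<alpha> f" for f
  proof -
    \<comment> \<open>The fibres of \<open>f\<close> over the variables are disjoint subsets of
      \<open>J\<close>, so the degree is at most \<open>N\<close> and some coordinate carries this
      exponent.\<close>
    have "(\<Sum>l\<in>UNIV. \<alpha> f l) = card (\<Union>l. {i \<in> J. f i = Some l})"
      unfolding \<alpha>_def using J(1) by (subst card_UN_disjoint) auto
    also have "\<dots> \<le> card J" using J(1) by (intro card_mono) auto
    finally have "\<alpha> f \<in> multi_indices N" using J(2) by (simp add: multi_indices_def)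
    with e show ?thesis by (intro f_inv_into_f) auto
  qed
  have monomial: "(\<Prod>l\<in>UNIV. (x $ l) ^ \<alpha> f l) = (\<Prod>i\<in>J. case_option 1 (\<lambda>l. x $ l) (f i))"
    for f and x :: "real ^ 'n"
  proof -
    \<comment> \<open>Group the factors by the chosen term; the group of \<open>None\<close>
      contributes 1.\<close>
    have "(\<Prod>i\<in>J. case_option 1 (\<lambda>l. x $ l) (f i))
        = (\<Prod>o'\<in>UNIV. \<Prod>i\<in>{i \<in> J. f i = o'}. case_option 1 (\<lambda>l. x $ l) (f i))"
      using J(1) by (intro prod.group[symmetric]) auto
    also have "\<dots> = (\<Prod>o'\<in>UNIV. case_option 1 (\<lambda>l. x $ l) o' ^ card {i \<in> J. f i = o'})"
      by (intro prod.cong) auto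
    also have "\<dots> = (\<Prod>l\<in>UNIV. (x $ l) ^ \<alpha> f l)"
      by (simp add: UNIV_option_conv prod.reindex \<alpha>_def)
    finally show ?thesis by simp
  qed
  show thesis
  proof
    fix x :: "real ^ 'n"
    have "c \<bullet> vandermonde_row e x = (\<Sum>f\<in>F. (\<Prod>i\<in>J. W i (f i)) * (\<Prod>l\<in>UNIV. (x $ l) ^ \<alpha> f l))"
      by (simp add: c_def inner_sum_left inner_axis' vandermonde_row_def e_inv)
    also have "\<dots> = (\<Sum>f\<in>F. \<Prod>i\<in>J. W i (f i) * case_option 1 (\<lambda>l. x $ l) (f i))"
      by (simp add: monomial prod.distrib)
    also have "\<dots> = (\<Prod>i\<in>J. \<Sum>o'\<in>UNIV. W i o' * case_option 1 (\<lambda>l. x $ l) o')"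
      unfolding F_def using J(1) by (intro prod_sum_PiE[symmetric]) auto
    also have "\<dots> = (\<Prod>i\<in>J. w i \<bullet> x - b i)"
      by (simp add: UNIV_option_conv sum.reindex W_def inner_vec_def)
    finally show "c \<bullet> vandermonde_row e x = (\<Prod>i\<in>J. w i \<bullet> x - b i)" .
  next
    have "norm c \<le> (\<Sum>f\<in>F. \<Prod>i\<in>J. \<bar>W i (f i)\<bar>)"
      unfolding c_def by (rule order_trans[OF norm_sum]) (simp add: abs_prod)
    also have "\<dots> = (\<Prod>i\<in>J. \<Sum>o'\<in>UNIV. \<bar>W i o'\<bar>)"
      unfolding F_def using J(1) by (intro prod_sum_PiE[symmetric]) auto
    also have "\<dots> = (\<Prod>i\<in>J. (\<Sum>l\<in>UNIV. \<bar>w i $ l\<bar>) + \<bar>b i\<bar>)"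
      by (simp add: UNIV_option_conv sum.reindex W_def add.commute)
    finally show "norm c \<le> (\<Prod>i\<in>J. (\<Sum>l\<in>UNIV. \<bar>w i $ l\<bar>) + \<bar>b i\<bar>)" .
  qed
qed

theorem theorem2p3:
  fixes z :: "nat \<Rightarrow> real ^ 'n"
    and e :: "'v::finite \<Rightarrow> 'n \<Rightarrow> nat"
    and s N j :: nat
  assumes "s \<ge> 2"
    and "inj_on z {1..s}"
    and "z ` {1..s} \<subseteq> cball 0 1"
    and "N \<ge> s - 1"
    and "bij_betw e UNIV (multi_indices N)"
    and "j \<in> {1..s}"
  shows "infdist (vandermonde_row e (z j)) (span (vandermonde_row e ` z ` ({1..s} - {j})))
           \<ge> proj_sep {1..s} z j ^ (s - 1) /
              ((4 * real CARD('n)) ^ (s - 1) * real s * sqrt (real ((N + CARD('n)) choose N)))"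
proof -
  define J where "J = {1..s} - {j}"
  define \<rho> where "\<rho> = proj_sep {1..s} z j"
  define D where "D = infdist (vandermonde_row e (z j)) (span (vandermonde_row e ` z ` J))"
  define \<nu> where "\<nu> = (N + CARD('n)) choose N"
  have "finite J" "card J = s - 1"
    using assms(6) by (simp_all add: J_def)
  then have J: "finite J" "card J = s - 1" "J \<noteq> {}"
    using assms(1) by auto
  obtain v where v: "norm v = 1" "\<rho> = (MIN i\<in>J. \<bar>v \<bullet> (z j - z i)\<bar>)"
    using proj_sep_attained[of "{1..s}" j z, folded J_def \<rho>_def, OF finite_atLeastAtMost J(3)]
    unfolding Bex_def mem_sphere_0 by blast
  have \<rho>_le: "\<rho> \<le> \<bar>v \<bullet> z j - v \<bullet> z i\<bar>" if "i \<in> J" for i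
    using that J by (simp add: v inner_diff_right)
  have \<rho>_nonneg: "0 \<le> \<rho>"
    using J by (simp add: v)
  have "multi_indices N \<subseteq> range e" using assms(5) by (simp add: bij_betw_def)
  then obtain c where c: "\<And>x. c \<bullet> vandermonde_row e x = (\<Prod>i\<in>J. v \<bullet> x - v \<bullet> z i)"
      "norm c \<le> (\<Prod>i\<in>J. (\<Sum>l\<in>UNIV. \<bar>v $ l\<bar>) + \<bar>v \<bullet> z i\<bar>)"
    using prod_affine_eq_inner_vandermonde_row[of N e J "\<lambda>_. v" "\<lambda>i. v \<bullet> z i"] J assms(4) by auto
  have norm_c: "norm c \<le> (4 * real CARD('n)) ^ (s - 1)"
  proof -
    \<comment> \<open>Each factor is at most \<open>n + 1\<close>, hence at most
      \<open>4 * n\<close> as \<open>n\<close> is at least 1.\<close>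
    have "(\<Sum>l\<in>UNIV. \<bar>v $ l\<bar>) + \<bar>v \<bullet> z i\<bar> \<le> 4 * real CARD('n)" if "i \<in> J" for i
    proof -
      have "(\<Sum>l\<in>UNIV. \<bar>v $ l\<bar>) \<le> real CARD('n)"
        using sum_bounded_above[of UNIV "\<lambda>l. \<bar>v $ l\<bar>" 1] component_le_norm_cart[of v] v(1) by simp
      moreover have "norm (z i) \<le> 1" using assms(3) that by (auto simp: J_def image_subset_iff)
      then have "\<bar>v \<bullet> z i\<bar> \<le> 1" using Cauchy_Schwarz_ineq2[of v "z i"] v(1) by simp
      moreover have "1 \<le> real CARD('n)" by (simp add: Suc_leI)
      ultimately show ?thesis by linarith
    qed
    then have "(\<Prod>i\<in>J. (\<Sum>l\<in>UNIV. \<bar>v $ l\<bar>) + \<bar>v \<bullet> z i\<bar>) \<le> (\<Prod>i\<in>J. 4 * real CARD('n))"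
      by (intro prod_mono) (auto intro!: add_nonneg_nonneg sum_nonneg)
    with c(2) J show ?thesis by simp
  qed
  have "\<rho> ^ (s - 1) = (\<Prod>i\<in>J. \<rho>)" using J by simp
  also have "\<dots> \<le> (\<Prod>i\<in>J. \<bar>v \<bullet> z j - v \<bullet> z i\<bar>)"
    using \<rho>_nonneg \<rho>_le by (intro prod_mono) auto
  also have "\<dots> = \<bar>c \<bullet> vandermonde_row e (z j)\<bar>" by (simp add: c(1) abs_prod)
  \<comment> \<open>For \<open>i \<in> J\<close> the product at \<open>z i\<close> has a zero
    factor, so \<open>c\<close> is orthogonal to the rows spanning the subspace.\<close>
  also have "\<dots> \<le> norm c * D"
    unfolding D_def using J(1)
    by (intro abs_inner_le_norm_times_infdist_span) (auto simp: c(1) prod_zero_iff)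
  also have "\<dots> \<le> (4 * real CARD('n)) ^ (s - 1) * D"
    using norm_c by (intro mult_right_mono) (auto simp: D_def infdist_nonneg)
  finally have "\<rho> ^ (s - 1) / (4 * real CARD('n)) ^ (s - 1) \<le> D"
    by (simp add: divide_le_eq mult.commute)
  \<comment> \<open>The remaining factor of the claimed denominator is at least 1, so inserting it
    only lowers the bound.\<close>
  moreover have "1 \<le> real s * sqrt (real \<nu>)"
  proof -
    have "0 < \<nu>" by (simp add: \<nu>_def)
    then have "1 \<le> sqrt (real \<nu>)" by simp
    then show ?thesis using assms(1) mult_mono[of 1 "real s" 1 "sqrt (real \<nu>)"] by simp
  qed
  then have "\<rho> ^ (s - 1) / ((4 * real CARD('n)) ^ (s - 1) * (real s * sqrt (real \<nu>)))
      \<le> \<rho> ^ (s - 1) / ((4 * real CARD('n)) ^ (s - 1) * 1)"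
    using \<rho>_nonneg assms(1) by (intro divide_left_mono mult_left_mono mult_pos_pos) (auto simp: \<nu>_def)
  ultimately show ?thesis
    by (simp add: \<rho>_def D_def \<nu>_def J_def mult.assoc)
qed

end
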